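(* Let $X\subset\mathbb{R}^s$ be open, let $C\subset\mathbb{R}^n$, $K\subset\mathbb{R}^m$ be closed convex pointed cones with vertex at the origin, with $\operatorname{int}(C)\neq\emptyset$, and let $f:X\to\mathbb{R}^n$ and $g:X\to\mathbb{R}^m$. Let $S=\{x\in X: g(x)\in -K\}$ and let $\bar x\in S$. Suppose that $f$ and $g$ are twice Fréchet differentiable at $\bar x$ and that $f$ is second-order pseudoconvex with respect to the cone $C$. Suppose that there exists a pair $(\lambda,\mu)\in C^*\times K^*$ such that $(\lambda,\mu)\neq(0,0)$, $$\lambda\cdot\nabla f(\bar x)+\mu\cdot\nabla g(\bar x)=0,$$ and $$\lambda\cdot(x-\bar x)\nabla^2 f(\bar x)(x-\bar x)+\mu\cdot(x-\bar x)\nabla^2 g(\bar x)(x-\bar x)\ge 0$$ for every direction $x-\bar x$ such that $$x\in S,\quad f(x)\in f(\bar x)-\operatorname{int}(C),\quad \nabla f(\bar x)(x-\bar x)\in-(C\setminus\operatorname{int}(C)),\quad \nabla g(\bar x)(x-\bar x)\in-(K\setminus\operatorname{int}(K)).$$ Suppose additionally that $\mu\cdot g(\bar x)=0$ and that, if $\mu\neq0$, the scalar function $x\mapsto\mu\cdot g(x)$ is second-order strictly pseudoconvex. Then $\bar x$ is a weakly efficient global solution of the problem (P): minimize $f(x)$ with respect to the cone $C$ subject to $g(x)\in -K$.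
   Context: A feasible point $\bar x\in S$ is a weakly efficient global solution of (P) if there is no other feasible point $x\in S$ with $f(x)\in f(\bar x)-\operatorname{int}(C)$. The positive polar cone is $C^*=\{\lambda\in\mathbb{R}^n : \lambda\cdot x\ge 0 \text{ for all } x\in C\}$, and similarly $K^*\subset\mathbb{R}^m$. Here $\lambda\cdot\nabla f(\bar x)=\sum_i\lambda_i\nabla f_i(\bar x)$, and $v\nabla^2 f(\bar x)v$ denotes the vector $\nabla^2 f(\bar x)(v,v)\in\mathbb{R}^n$ with components $\nabla^2 f_i(\bar x)(v,v)$; similarly for $\mu$ and $g$. A twice Fréchet differentiable function $f:X\to\mathbb{R}^n$ is second-order pseudoconvex with respect to $C$ if for all $x,y\in X$ with $f(x)\in f(y)-\operatorname{int}(C)$: (i) $\nabla f(y)(x-y)\in -C$; and (ii) if $\nabla f(y)(x-y)\in-(C\setminus\operatorname{int}(C))$, then $(x-y)\nabla^2 f(y)(x-y)\in-\operatorname{int}(C)$. A twice Fréchet differentiable function $h:X\to\mathbb{R}$ is second-order strictly pseudoconvex if for all $x,y\in X$ with $x\neq y$ and $h(x)\le h(y)$: (i) $\nabla h(y)(x-y)\le 0$; and (ii) if $\nabla h(y)(x-y)=0$, then $(x-y)\nabla^2 h(y)(x-y)<0$. *)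

theory Defs
  imports "HOL-Analysis.Analysis"
begin

definition closed_convex_pointed_cone :: "'a::real_normed_vector set \<Rightarrow> bool" where
  "closed_convex_pointed_cone C \<longleftrightarrow>
     closed C \<and> convex C \<and> cone C \<and> C \<inter> uminus ` C = {0}"

definition positive_polar_cone :: "'a::real_inner set \<Rightarrow> 'a set" where
  "positive_polar_cone C = {l. \<forall>x\<in>C. 0 \<le> l \<bullet> x}"

text \<open>
  The gradient is bundled as a bounded linear map so that differentiating it once more refers to
  the operator norm. The value of \<^term>\<open>Blinfun\<close> is meaningful only at points of differentiability.
\<close>

definition gradient :: "('a::real_normed_vector \<Rightarrow> 'b::real_normed_vector) \<Rightarrow> 'a \<Rightarrow> 'a \<Rightarrow>\<^sub>L 'b" where
  "gradient f x = Blinfun (frechet_derivative f (at x))"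

definition twice_frechet_differentiable_at ::
    "('a::real_normed_vector \<Rightarrow> 'b::real_normed_vector) \<Rightarrow> 'a \<Rightarrow> bool" where
  "twice_frechet_differentiable_at f x \<longleftrightarrow>
     (\<forall>\<^sub>F y in nhds x. f differentiable at y) \<and> gradient f differentiable at x"

definition second_derivative ::
    "('a::real_normed_vector \<Rightarrow> 'b::real_normed_vector) \<Rightarrow> 'a \<Rightarrow> 'a \<Rightarrow> 'a \<Rightarrow> 'b" where
  "second_derivative f x u v = blinfun_apply (frechet_derivative (gradient f) (at x) u) v"

text \<open>
  Functions on a set \<open>X\<close> are total functions of which only the values on \<open>X\<close> matter. The
  derivatives above are unrestricted, so the notions below are intended for open \<open>X\<close>.
  Membership of \<open>u\<close> in \<open>w - A\<close> is written \<open>w - u \<in> A\<close>, and membership in \<open>- A\<close> as \<open>- u \<in> A\<close>.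
\<close>

definition second_order_pseudoconvex_on ::
    "'a::real_normed_vector set \<Rightarrow> 'b::real_normed_vector set \<Rightarrow> ('a \<Rightarrow> 'b) \<Rightarrow> bool" where
  "second_order_pseudoconvex_on X C f \<longleftrightarrow>
     (\<forall>x\<in>X. twice_frechet_differentiable_at f x) \<and>
     (\<forall>x\<in>X. \<forall>y\<in>X. f y - f x \<in> interior C \<longrightarrow>
        - gradient f y (x - y) \<in> C \<and>
        (- gradient f y (x - y) \<in> C - interior C \<longrightarrow>
           - second_derivative f y (x - y) (x - y) \<in> interior C))"

definition second_order_strictly_pseudoconvex_on ::
    "'a::real_normed_vector set \<Rightarrow> ('a \<Rightarrow> real) \<Rightarrow> bool" where
  "second_order_strictly_pseudoconvex_on X h \<longleftrightarrow>
     (\<forall>x\<in>X. twice_frechet_differentiable_at h x) \<and>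
     (\<forall>x\<in>X. \<forall>y\<in>X. x \<noteq> y \<and> h x \<le> h y \<longrightarrow>
        gradient h y (x - y) \<le> 0 \<and>
        (gradient h y (x - y) = 0 \<longrightarrow> second_derivative h y (x - y) (x - y) < 0))"

definition feasible_set :: "'a set \<Rightarrow> ('a \<Rightarrow> 'b::real_normed_vector) \<Rightarrow> 'b set \<Rightarrow> 'a set" where
  "feasible_set X g K = {x \<in> X. - g x \<in> K}"

definition weakly_efficient_global_solution ::
    "'a set \<Rightarrow> ('a \<Rightarrow> 'b::real_normed_vector) \<Rightarrow> 'b set \<Rightarrow> ('a \<Rightarrow> 'c::real_normed_vector) \<Rightarrow> 'c set
      \<Rightarrow> 'a \<Rightarrow> bool" where
  "weakly_efficient_global_solution X f C g K a \<longleftrightarrow>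
     a \<in> feasible_set X g K \<and>
     \<not> (\<exists>x\<in>feasible_set X g K. x \<noteq> a \<and> f a - f x \<in> interior C)"

end

theory Submission imports Defs begin

text \<open>
  The main point is that second-order pseudoconvexity on an open set already forces a strict
  first-order decrease. Call \<open>x\<close> better than \<open>a\<close> if \<open>f a - f x\<close> is interior to \<open>C\<close>.
  For such \<open>x\<close> put \<open>d = x - a\<close>, \<open>v = f'(a) d\<close> and \<open>w = f''(a)(d, d)\<close>, and suppose that
  \<open>l \<bullet> v = 0\<close> for some nonzero \<open>l\<close> in the polar cone. By pseudoconvexity \<open>v\<close> lies in \<open>- C\<close>,
  hence on its boundary because \<open>l\<close> is negative on the interior of \<open>- C\<close>, and so \<open>w\<close> lies in
  the interior of \<open>- C\<close>. Along the line through \<open>a\<close> with direction \<open>d\<close> the function looks like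
  \<open>f a + t v + t\<^sup>2 w / 2\<close>. For small \<open>s > 0\<close> the point \<open>a + 2 s d\<close> is therefore better than
  \<open>a - s d\<close>: both the linear and the quadratic term improve. But the derivative at \<open>a - s d\<close> in
  direction \<open>d\<close> is about \<open>v - s w\<close>, on which \<open>l\<close> is positive, whereas pseudoconvexity at
  \<open>a - s d\<close> requires \<open>l\<close> to be at most zero there. Hence \<open>l \<bullet> v < 0\<close>; this is
  \<open>pseudoconvex_imp_strict_descent\<close>, and \<open>strictly_pseudoconvex_imp_strict_descent\<close> is its
  counterpart for strictly pseudoconvex scalar functions. Both follow from
  \<open>no_concave_critical_direction\<close>.

  If some feasible \<open>x\<close> were better than \<open>a\<close>, then \<open>l \<bullet> f'(a)(x - a)\<close> would be negative unless
  \<open>l = 0\<close>, and, since \<open>\<mu> \<bullet> g x \<le> 0 = \<mu> \<bullet> g a\<close>, also \<open>\<mu> \<bullet> g'(a)(x - a)\<close> would be negative unless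
  \<open>\<mu> = 0\<close>. As \<open>l\<close> and \<open>\<mu>\<close> are not both zero, the sum would be negative, which contradicts the
  multiplier equation.
\<close>

section \<open>Convex cones and their polars\<close>

lemma interior_convex_cone_scaleR:
  fixes C :: "'a::real_normed_vector set"
  assumes "convex_cone C" "z \<in> interior C" "0 < c"
  shows "c *\<^sub>R z \<in> interior C"
proof -
  have "(\<lambda>x. c *\<^sub>R x) ` interior C \<subseteq> interior C"
  proof (rule interior_maximal)
    show "(\<lambda>x. c *\<^sub>R x) ` interior C \<subseteq> C"
      using convex_cone_scaleR[OF assms(1)] assms(3) interior_subset[of C]
      by (intro image_subsetI) (simp add: subset_iff)
    show "open ((\<lambda>x. c *\<^sub>R x) ` interior C)"
      using assms(3) by (intro open_scaling) auto
  qed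
  with assms(2) show ?thesis by blast
qed

lemma interior_convex_cone_add:
  fixes C :: "'a::real_normed_vector set"
  assumes "convex_cone C" "u \<in> C" "z \<in> interior C"
  shows "u + z \<in> interior C"
proof -
  have "(+) u ` interior C \<subseteq> interior C"
  proof (rule interior_maximal)
    show "(+) u ` interior C \<subseteq> C"
      using convex_cone_add[OF assms(1,2)] interior_subset[of C]
      by (intro image_subsetI) (simp add: subset_iff)
    show "open ((+) u ` interior C)"
      by (intro open_translation) auto
  qed
  with assms(3) show ?thesis by blast
qed

lemma closed_convex_pointed_cone_imp_convex_cone:
  assumes "closed_convex_pointed_cone C"
  shows "convex_cone C"
proof -
  have "0 \<in> C"
    using assms unfolding closed_convex_pointed_cone_def by blast
  then show ?thesis
    using assms convex_cone[of C] by (simp add: closed_convex_pointed_cone_def convex_cone_iff)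
qed

text \<open>
  A nonzero element of the polar cone is strictly positive on the interior, since an interior
  point can be moved a little in the direction \<open>- l\<close> without leaving the cone.
\<close>

lemma positive_polar_cone_interior_pos:
  fixes C :: "'a::real_inner set"
  assumes "l \<in> positive_polar_cone C" "l \<noteq> 0" "z \<in> interior C"
  shows "0 < l \<bullet> z"
proof -
  obtain e where e: "0 < e" "ball z e \<subseteq> C"
    using assms(3) mem_interior by blast
  define c where "c = e / (2 * norm l)"
  have "0 < c"
    using e(1) assms(2) by (simp add: c_def)
  have "norm (c *\<^sub>R l) = e / 2"
    using e(1) assms(2) by (simp add: c_def)
  then have "z - c *\<^sub>R l \<in> C"
    using e by (auto simp: dist_norm subset_eq)
  then have "0 \<le> l \<bullet> z - c * (l \<bullet> l)"
    using assms(1) by (auto simp: positive_polar_cone_def inner_diff_right)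
  moreover have "0 < c * (l \<bullet> l)"
    using \<open>0 < c\<close> assms(2) by simp
  ultimately show ?thesis by linarith
qed

section \<open>Second-order expansion along a line\<close>

lemma has_derivative_gradient:
  assumes "f differentiable at x"
  shows "(f has_derivative gradient f x) (at x)"
proof -
  have d: "(f has_derivative frechet_derivative f (at x)) (at x)"
    using assms frechet_derivative_works by blast
  then show ?thesis
    by (simp add: gradient_def bounded_linear_Blinfun_apply[OF has_derivative_bounded_linear])
qed

lemma gradient_inner_left:
  fixes g :: "'a::real_normed_vector \<Rightarrow> 'b::real_inner"
  assumes "g differentiable at x"
  shows "gradient (\<lambda>y. m \<bullet> g y) x d = m \<bullet> gradient g x d"
proof -
  have *: "((\<lambda>y. m \<bullet> g y) has_derivative (\<lambda>d. m \<bullet> gradient g x d)) (at x)"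
    using has_derivative_inner_right[OF has_derivative_gradient[OF assms]] .
  then have "(\<lambda>y. m \<bullet> g y) differentiable at x"
    by (rule differentiableI)
  from has_derivative_unique[OF has_derivative_gradient[OF this] *]
  show ?thesis by meson
qed

lemma twice_frechet_differentiable_at_imp_differentiable:
  "twice_frechet_differentiable_at f x \<Longrightarrow> f differentiable at x"
  unfolding twice_frechet_differentiable_at_def using eventually_nhds_x_imp_x by fast

lemma gradient_expansion_along_line:
  assumes "twice_frechet_differentiable_at f a" "0 < e"
  obtains \<delta> where "0 < \<delta>"
    and "\<And>t. \<bar>t\<bar> < \<delta> \<Longrightarrow> f differentiable at (a + t *\<^sub>R d)"
    and "\<And>t. \<bar>t\<bar> < \<delta> \<Longrightarrow>
      norm (gradient f (a + t *\<^sub>R d) d - gradient f a d - t *\<^sub>R second_derivative f a d d) \<le> e * \<bar>t\<bar>"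
proof -
  define D where "D = frechet_derivative (gradient f) (at a)"
  have D: "(gradient f has_derivative D) (at a)"
    using assms(1) unfolding twice_frechet_differentiable_at_def D_def
    by (simp add: frechet_derivative_works)
  interpret D: bounded_linear D
    using D has_derivative_bounded_linear by blast
  define N where "N = norm d + 1"
  have N: "0 < N" "norm d \<le> N"
    unfolding N_def by (auto intro: add_nonneg_pos)
  have e': "0 < e / (N * N)"
    using assms(2) N by simp
  obtain \<delta>1 where \<delta>1: "0 < \<delta>1"
      "\<And>y. norm (y - a) < \<delta>1 \<Longrightarrow>
        norm (gradient f y - gradient f a - D (y - a)) \<le> e / (N * N) * norm (y - a)"
    using conjunct2[OF D[unfolded has_derivative_at_alt], rule_format, OF e'] by blast
  obtain \<delta>2 where \<delta>2: "0 < \<delta>2" "\<And>y. dist y a < \<delta>2 \<Longrightarrow> f differentiable at y"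
    using assms(1) unfolding twice_frechet_differentiable_at_def eventually_nhds_metric by blast
  define \<delta> where "\<delta> = min \<delta>1 \<delta>2 / N"
  have near: "norm (t *\<^sub>R d) < min \<delta>1 \<delta>2" if "\<bar>t\<bar> < \<delta>" for t
  proof -
    have "norm (t *\<^sub>R d) \<le> \<bar>t\<bar> * N"
      using N by (simp add: mult_left_mono)
    also have "\<dots> < min \<delta>1 \<delta>2"
      using that N by (simp add: \<delta>_def pos_less_divide_eq)
    finally show ?thesis .
  qed
  show thesis
  proof
    show "0 < \<delta>"
      using \<delta>1(1) \<delta>2(1) N by (simp add: \<delta>_def)
    show "f differentiable at (a + t *\<^sub>R d)" if "\<bar>t\<bar> < \<delta>" for t
      using near[OF that] by (intro \<delta>2(2)) (simp add: dist_norm)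
    show "norm (gradient f (a + t *\<^sub>R d) d - gradient f a d - t *\<^sub>R second_derivative f a d d)
        \<le> e * \<bar>t\<bar>" if "\<bar>t\<bar> < \<delta>" for t
    proof -
      let ?R = "gradient f (a + t *\<^sub>R d) - gradient f a - D (t *\<^sub>R d)"
      have R: "norm ?R \<le> e / (N * N) * norm (t *\<^sub>R d)"
        using \<delta>1(2)[of "a + t *\<^sub>R d"] near[OF that] by simp
      have "gradient f (a + t *\<^sub>R d) d - gradient f a d - t *\<^sub>R second_derivative f a d d = ?R d"
        by (simp add: second_derivative_def D_def[symmetric] D.scaleR blinfun.diff_left
            blinfun.scaleR_left)
      also have "norm \<dots> \<le> norm ?R * norm d"
        by (rule norm_blinfun)
      also have "\<dots> \<le> e / (N * N) * norm (t *\<^sub>R d) * norm d"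
        by (intro mult_right_mono R) simp
      also have "\<dots> = e / (N * N) * \<bar>t\<bar> * (norm d * norm d)"
        by simp
      also have "\<dots> \<le> e / (N * N) * \<bar>t\<bar> * (N * N)"
        using N e' by (intro mult_left_mono mult_mono mult_nonneg_nonneg) auto
      also have "\<dots> = e * \<bar>t\<bar>"
        using N by simp
      finally show ?thesis .
    qed
  qed
qed

text \<open>
  The function along the line minus its quadratic part has derivative
  \<open>f'(a) d + o(t)\<close>, so the mean value inequality applies on \<open>[- s, 2 s]\<close>. The two endpoints must
  not be symmetric about \<open>a\<close>: the quadratic term would cancel between \<open>- s\<close> and \<open>s\<close>.
\<close>

lemma asymmetric_difference_expansion:
  assumes diff: "\<And>t. \<bar>t\<bar> \<le> 2 * s \<Longrightarrow> f differentiable at (a + t *\<^sub>R d)"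
    and bound: "\<And>t. \<bar>t\<bar> \<le> 2 * s \<Longrightarrow>
      norm (gradient f (a + t *\<^sub>R d) d - gradient f a d - t *\<^sub>R w) \<le> e * \<bar>t\<bar>"
    and "0 < s" "0 < e"
  shows "norm (f (a + (2 * s) *\<^sub>R d) - f (a + (- s) *\<^sub>R d)
      - (3 * s) *\<^sub>R gradient f a d - (3 / 2 * s\<^sup>2) *\<^sub>R w) \<le> 6 * e * s\<^sup>2"
proof -
  define r where "r = (\<lambda>t. f (a + t *\<^sub>R d) - (t\<^sup>2 / 2) *\<^sub>R w)"
  define r' where "r' = (\<lambda>t. gradient f (a + t *\<^sub>R d) d - t *\<^sub>R w)"
  have r: "(r has_vector_derivative r' t) (at t within S)" if "\<bar>t\<bar> \<le> 2 * s" for t S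
  proof -
    have line: "((\<lambda>t. a + t *\<^sub>R d) has_derivative (\<lambda>h. h *\<^sub>R d)) (at t)"
      by (auto intro!: derivative_eq_intros)
    have "((\<lambda>t. f (a + t *\<^sub>R d)) has_derivative
        (\<lambda>h. gradient f (a + t *\<^sub>R d) (h *\<^sub>R d))) (at t)"
      using has_derivative_compose[OF line has_derivative_gradient[OF diff[OF that]]] .
    then have f: "((\<lambda>t. f (a + t *\<^sub>R d)) has_vector_derivative gradient f (a + t *\<^sub>R d) d) (at t)"
      by (simp add: has_vector_derivative_def blinfun.scaleR_right)
    have "((\<lambda>t. t\<^sup>2 / 2) has_field_derivative t) (at t)"
      by (auto intro!: derivative_eq_intros)
    then have "((\<lambda>t. (t\<^sup>2 / 2) *\<^sub>R w) has_vector_derivative t *\<^sub>R w) (at t)"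
      by (auto intro!: derivative_eq_intros)
    from has_vector_derivative_diff[OF f this]
    show ?thesis
      unfolding r_def r'_def by (rule has_vector_derivative_at_within)
  qed
  have "norm (r (2 * s) - r (- s) - (2 * s - (- s)) *\<^sub>R r' 0) \<le> norm (2 * s - (- s)) * (e * (2 * s))"
  proof (rule vector_differentiable_bound_linearization[where S = "{- s..2 * s}"])
    show "(r has_vector_derivative r' t) (at t within {- s..2 * s})" if "t \<in> {- s..2 * s}" for t
      using that by (intro r) auto
    show "norm (r' t - r' 0) \<le> e * (2 * s)" if "t \<in> {- s..2 * s}" for t
    proof -
      have t: "\<bar>t\<bar> \<le> 2 * s" using that by auto
      have "norm (r' t - r' 0) \<le> e * \<bar>t\<bar>"
        using bound[OF t] by (simp add: r'_def algebra_simps)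
      also have "\<dots> \<le> e * (2 * s)"
        using t \<open>0 < e\<close> by (intro mult_left_mono) auto
      finally show ?thesis .
    qed
  qed (use \<open>0 < s\<close> in \<open>auto simp: closed_segment_eq_real_ivl\<close>)
  moreover have "(4 * s\<^sup>2 / 2) *\<^sub>R w - (s\<^sup>2 / 2) *\<^sub>R w = (3 / 2 * s\<^sup>2) *\<^sub>R w"
    by (simp flip: scaleR_left_diff_distrib)
  then have "r (2 * s) - r (- s) - (2 * s - (- s)) *\<^sub>R r' 0 =
      f (a + (2 * s) *\<^sub>R d) - f (a + (- s) *\<^sub>R d)
      - (3 * s) *\<^sub>R gradient f a d - (3 / 2 * s\<^sup>2) *\<^sub>R w"
    by (simp add: r_def r'_def power_mult_distrib algebra_simps)
  ultimately show ?thesis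
    using \<open>0 < s\<close> by (simp add: power2_eq_square mult_ac)
qed

section \<open>Second-order pseudoconvexity forces first-order descent\<close>

text \<open>
  Otherwise \<open>l\<close> would vanish on \<open>f'(a) d\<close>, and for small \<open>s\<close> the pair \<open>a + 2 s d\<close>, \<open>a - s d\<close> would
  violate first-order pseudoconvexity: the first point is better than the second, while
  the derivative at the second in direction \<open>d\<close> has a positive product with \<open>l\<close>.
\<close>

lemma no_concave_critical_direction:
  fixes f :: "'a::real_normed_vector \<Rightarrow> 'b::real_inner"
  assumes X: "open X" "a \<in> X" and C: "convex_cone C"
    and f: "twice_frechet_differentiable_at f a"
    and pc: "\<And>x y. x \<in> X \<Longrightarrow> y \<in> X \<Longrightarrow> f y - f x \<in> interior C \<Longrightarrow> - gradient f y (x - y) \<in> C"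
    and l: "l \<in> positive_polar_cone C" "l \<noteq> 0"
    and first: "- gradient f a d \<in> C"
    and second: "- second_derivative f a d d \<in> interior C"
  shows "l \<bullet> gradient f a d < 0"
proof (rule ccontr)
  assume not_less: "\<not> l \<bullet> gradient f a d < 0"
  define v w where "v = gradient f a d" and "w = second_derivative f a d d"
  have "0 \<le> l \<bullet> (- v)"
    using l(1) first by (simp add: positive_polar_cone_def v_def del: inner_minus_right)
  with not_less have lv: "l \<bullet> v = 0"
    by (simp add: v_def)
  obtain \<rho> where \<rho>: "0 < \<rho>" "ball (- w) \<rho> \<subseteq> interior C"
    using second open_interior[of C] unfolding open_contains_ball w_def by blast
  \<comment> \<open>The difference quotient below has error at most \<open>4 e\<close>, which must stay below \<open>\<rho>\<close>.\<close>
  define e where "e = \<rho> / 5"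
  have e: "0 < e" "4 * e < \<rho>"
    using \<rho>(1) by (simp_all add: e_def)
  obtain \<delta> where \<delta>: "0 < \<delta>"
      "\<And>t. \<bar>t\<bar> < \<delta> \<Longrightarrow> f differentiable at (a + t *\<^sub>R d)"
      "\<And>t. \<bar>t\<bar> < \<delta> \<Longrightarrow> norm (gradient f (a + t *\<^sub>R d) d - v - t *\<^sub>R w) \<le> e * \<bar>t\<bar>"
    using gradient_expansion_along_line[OF f e(1), of d] unfolding v_def w_def by blast
  have "((\<lambda>t. a + t *\<^sub>R d) \<longlongrightarrow> a + 0 *\<^sub>R d) (at 0)"
    by (intro tendsto_intros)
  then have "\<forall>\<^sub>F t in at 0. a + t *\<^sub>R d \<in> X"
    using X by (simp add: topological_tendstoD)
  then obtain \<eta> where \<eta>: "0 < \<eta>" "\<And>t. t \<noteq> 0 \<Longrightarrow> \<bar>t\<bar> < \<eta> \<Longrightarrow> a + t *\<^sub>R d \<in> X"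
    unfolding eventually_at by auto
  define s where "s = min \<delta> \<eta> / 3"
  have s: "0 < s" "2 * s < \<delta>" "2 * s < \<eta>"
    using \<delta>(1) \<eta>(1) by (auto simp: s_def min_def)
  define x y where "x = a + (2 * s) *\<^sub>R d" and "y = a + (- s) *\<^sub>R d"
  have xy: "x \<in> X" "y \<in> X"
    unfolding x_def y_def using s by (auto intro!: \<eta>(2) simp del: scaleR_minus_left)
  have "f y - f x \<in> interior C"
  proof -
    define q where "q = (1 / (3 / 2 * s\<^sup>2)) *\<^sub>R (f y - f x + (3 * s) *\<^sub>R v)"
    have s2: "0 < 3 / 2 * s\<^sup>2"
      using s(1) by simp
    have expansion: "norm (f x - f y - (3 * s) *\<^sub>R v - (3 / 2 * s\<^sup>2) *\<^sub>R w) \<le> 6 * e * s\<^sup>2"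
      unfolding x_def y_def v_def
      by (rule asymmetric_difference_expansion) (use \<delta> s e in \<open>auto simp: v_def\<close>)
    have q: "(3 / 2 * s\<^sup>2) *\<^sub>R q = f y - f x + (3 * s) *\<^sub>R v"
      using s(1) by (simp add: q_def)
    have "(3 / 2 * s\<^sup>2) * norm (- w - q) = norm ((3 / 2 * s\<^sup>2) *\<^sub>R (- w - q))"
      using s2 by simp
    also have "(3 / 2 * s\<^sup>2) *\<^sub>R (- w - q) = f x - f y - (3 * s) *\<^sub>R v - (3 / 2 * s\<^sup>2) *\<^sub>R w"
      unfolding scaleR_diff_right q by simp
    also have "norm \<dots> \<le> (3 / 2 * s\<^sup>2) * (4 * e)"
      using expansion by simp
    finally have "norm (- w - q) \<le> 4 * e"
      using s2 by (rule mult_left_le_imp_le)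
    then have "q \<in> interior C"
      using \<rho>(2) e(2) by (auto simp: dist_norm subset_eq)
    then have "(3 / 2 * s\<^sup>2) *\<^sub>R q \<in> interior C"
      using interior_convex_cone_scaleR[OF C] s2 by blast
    moreover have "(3 * s) *\<^sub>R (- v) \<in> C"
      using convex_cone_scaleR[OF C _ first] s(1) by (simp add: v_def)
    ultimately have "(3 * s) *\<^sub>R (- v) + (3 / 2 * s\<^sup>2) *\<^sub>R q \<in> interior C"
      using interior_convex_cone_add[OF C] by blast
    then show ?thesis
      unfolding q by simp
  qed
  then have "- gradient f y (x - y) \<in> C"
    using pc xy by blast
  moreover have "x - y = (3 * s) *\<^sub>R d"
    by (simp add: x_def y_def flip: scaleR_add_left)
  ultimately have "0 \<le> l \<bullet> (- gradient f y ((3 * s) *\<^sub>R d))"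
    using l(1) by (simp add: positive_polar_cone_def del: inner_minus_right)
  then have nonpos: "l \<bullet> gradient f y d \<le> 0"
    using s(1) by (simp add: blinfun.scaleR_right mult_le_0_iff)
  define p where "p = (1 / s) *\<^sub>R (gradient f y d - v)"
  have p: "s *\<^sub>R p = gradient f y d - v"
    using s(1) by (simp add: p_def)
  have "s * norm (- w - p) = norm (s *\<^sub>R (- w - p))"
    using s(1) by simp
  also have "\<dots> = norm (gradient f y d - v - (- s) *\<^sub>R w)"
    unfolding scaleR_diff_right p by (simp add: norm_minus_commute algebra_simps)
  also have "\<dots> \<le> s * e"
    using \<delta>(3)[of "- s"] s by (simp add: y_def mult.commute)
  finally have "norm (- w - p) \<le> e"
    using s(1) by (rule mult_left_le_imp_le)
  then have "p \<in> interior C"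
    using \<rho>(2) e by (auto simp: dist_norm subset_eq)
  then have "0 < l \<bullet> (s *\<^sub>R p)"
    using positive_polar_cone_interior_pos[OF l] s(1) by simp
  then show False
    unfolding p using nonpos lv by (simp add: inner_diff_right)
qed

text \<open>
  Either the derivative lies in the interior of \<open>- C\<close>, where \<open>l\<close> is negative, or it lies on the
  boundary and the second-order condition applies.
\<close>

lemma pseudoconvex_imp_strict_descent:
  fixes f :: "'a::real_normed_vector \<Rightarrow> 'b::real_inner"
  assumes "open X" "convex_cone C" "second_order_pseudoconvex_on X C f"
    and "l \<in> positive_polar_cone C" "l \<noteq> 0"
    and "a \<in> X" "x \<in> X" "f a - f x \<in> interior C"
  shows "l \<bullet> gradient f a (x - a) < 0"
proof (cases "- gradient f a (x - a) \<in> interior C")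
  case True
  from positive_polar_cone_interior_pos[OF assms(4,5) this] show ?thesis by simp
next
  case False
  then show ?thesis
    using assms unfolding second_order_pseudoconvex_on_def
    by (intro no_concave_critical_direction[where X = X and C = C]) auto
qed

text \<open>
  This is the scalar case \<open>C = {0..}\<close>, \<open>l = 1\<close>, except that \<open>x\<close> need not be strictly better than \<open>a\<close>.
\<close>

lemma strictly_pseudoconvex_imp_strict_descent:
  fixes h :: "'a::real_normed_vector \<Rightarrow> real"
  assumes "open X" "second_order_strictly_pseudoconvex_on X h"
    and "a \<in> X" "x \<in> X" "x \<noteq> a" "h x \<le> h a"
  shows "gradient h a (x - a) < 0"
proof (rule ccontr)
  assume "\<not> ?thesis"
  with assms have zero: "gradient h a (x - a) = 0"
    and neg: "second_derivative h a (x - a) (x - a) < 0"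
    unfolding second_order_strictly_pseudoconvex_on_def by force+
  have "1 \<bullet> gradient h a (x - a) < 0"
  proof (rule no_concave_critical_direction[where X = X and C = "{0..}"])
    show "convex_cone {0::real..}"
      by (auto simp: convex_cone_iff)
    show "- gradient h y (x - y) \<in> {0..}"
      if "x \<in> X" "y \<in> X" "h y - h x \<in> interior {0..}" for x y
    proof -
      have "x \<noteq> y" "h x \<le> h y"
        using that(3) by auto
      then show ?thesis
        using assms(2) that(1,2) unfolding second_order_strictly_pseudoconvex_on_def by simp
    qed
    show "twice_frechet_differentiable_at h a"
      using assms(2,3) unfolding second_order_strictly_pseudoconvex_on_def by blast
  qed (use assms zero neg in \<open>auto simp: positive_polar_cone_def\<close>)
  with zero show False by simp
qed

section \<open>Sufficient conditions for weak efficiency\<close>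

theorem theorem6:
  fixes X :: "(real ^ 's) set"
    and C :: "(real ^ 'n) set" and K :: "(real ^ 'm) set"
    and f :: "real ^ 's \<Rightarrow> real ^ 'n" and g :: "real ^ 's \<Rightarrow> real ^ 'm"
    and a :: "real ^ 's"
    and l :: "real ^ 'n" and \<mu> :: "real ^ 'm"
  assumes "open X"
    and "closed_convex_pointed_cone C" and "closed_convex_pointed_cone K"
    and "interior C \<noteq> {}"
    and "a \<in> feasible_set X g K"
    and "twice_frechet_differentiable_at f a" and "twice_frechet_differentiable_at g a"
    and "second_order_pseudoconvex_on X C f"
    and "l \<in> positive_polar_cone C" and "\<mu> \<in> positive_polar_cone K"
    and "(l, \<mu>) \<noteq> (0, 0)"
    and "\<forall>d. l \<bullet> gradient f a d + \<mu> \<bullet> gradient g a d = 0"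
    and "\<forall>x\<in>feasible_set X g K.
           f a - f x \<in> interior C \<and>
           - gradient f a (x - a) \<in> C - interior C \<and>
           - gradient g a (x - a) \<in> K - interior K \<longrightarrow>
           l \<bullet> second_derivative f a (x - a) (x - a)
             + \<mu> \<bullet> second_derivative g a (x - a) (x - a) \<ge> 0"
    and "\<mu> \<bullet> g a = 0"
    and "\<mu> \<noteq> 0 \<longrightarrow> second_order_strictly_pseudoconvex_on X (\<lambda>x. \<mu> \<bullet> g x)"
  shows "weakly_efficient_global_solution X f C g K a"
proof -
  have a: "a \<in> X"
    using assms(5) by (simp add: feasible_set_def)
  have "False" if x: "x \<in> feasible_set X g K" "x \<noteq> a" "f a - f x \<in> interior C" for x
  proof -
    have xX: "x \<in> X" and gx: "- g x \<in> K"
      using x(1) by (auto simp: feasible_set_def)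
    have f_descent: "l \<bullet> gradient f a (x - a) < 0" if "l \<noteq> 0"
      using pseudoconvex_imp_strict_descent[OF assms(1)
          closed_convex_pointed_cone_imp_convex_cone[OF assms(2)] assms(8,9) that a xX x(3)] .
    have g_descent: "\<mu> \<bullet> gradient g a (x - a) < 0" if "\<mu> \<noteq> 0"
    proof -
      have "0 \<le> \<mu> \<bullet> (- g x)"
        using assms(10) gx unfolding positive_polar_cone_def by blast
      then have "\<mu> \<bullet> g x \<le> \<mu> \<bullet> g a"
        using assms(14) by simp
      then have "gradient (\<lambda>y. \<mu> \<bullet> g y) a (x - a) < 0"
        using strictly_pseudoconvex_imp_strict_descent[OF assms(1) _ a xX x(2)] assms(15) that
        by blast
      then show ?thesis
        using gradient_inner_left twice_frechet_differentiable_at_imp_differentiable[OF assms(7)]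
        by metis
    qed
    have "l \<bullet> gradient f a (x - a) + \<mu> \<bullet> gradient g a (x - a) < 0"
      using f_descent g_descent assms(11) by (cases "l = 0"; cases "\<mu> = 0") auto
    then show False
      using assms(12) by simp
  qed
  then show ?thesis
    using assms(5) unfolding weakly_efficient_global_solution_def by blast
qed

end
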